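(* Let $(M,S,\eta)$ be a factorable monoid, write $f'=\eta'(f)$ and $\overline{f}=\overline{\eta}(f)$ for $f\in M$, and let $\varphi$ be the restriction of $\eta\mu$ to $S^2$. If $\varphi_1\varphi_2\varphi_1\varphi_2(r,s,t)=\varphi_2\varphi_1\varphi_2(r,s,t)$ for each $(r,s,t)\in S_+^3$ such that $\varphi_2\varphi_1\varphi_2(r,s,t)$ contains $1$, then for all $s\in S_+$ and $f\in M$, $$(sf)'=(sf')'\quad\text{and}\quad \overline{sf}=\overline{sf'}\cdot\overline{f}.$$
   Context: $M$ is a monoid with multiplication $\mu:M^2\to M$, $S\subseteq M$ is a generating subset with $1\in S$, and $S_+=S\setminus\{1\}$. For $f\in M$, $|f|$ is the minimal length of an $S$-word representing $f$ (so $|1|=0$). For a set $A$ and $F:A^2\to A^2$, $F_i$ applies $F$ to the entries at positions $i,i+1$ of a tuple over $A$ (counted from the left). Compositions are read with the rightmost map applied first. A factorisation map for $(M,S)$ is a map $\eta=(\eta',\overline{\eta}):M\to M^2$ with $\eta(1)=(1,1)$ and, for every $f\ne1$: $\eta'(f)\in S_+$, $\eta'(f)\cdot\overline{\eta}(f)=f$, $|f|=|\eta'(f)|+|\overline{\eta}(f)|$. It is a factorability structure, and $(M,S,\eta)$ is a factorable monoid, if, with $F=\eta\circ\mu$, for every triple in $M^3$ either $F_1F_2F_1F_2$, $F_2F_1F_2$, $F_2F_1F_2F_1$ take the same value on it or each of these three maps strictly reduces the sum of the lengths $|\cdot|$ of the entries. The restriction $\varphi$ of $\eta\mu$ to $S^2$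 takes values in $S^2$. *)

theory Defs
  imports Main "HOL-Library.FuncSet"
begin

text \<open>The monoid \<open>M\<close> is the carrier type \<open>'a\<close>, of class \<^class>\<open>monoid_mult\<close>;
  \<open>S\<close> is a set of elements of that type.\<close>

definition mult_map :: "'a::monoid_mult \<times> 'a \<Rightarrow> 'a" where
  "mult_map = (\<lambda>(f, g). f * g)"

definition generates :: "'a::monoid_mult set \<Rightarrow> bool" where
  "generates S \<longleftrightarrow> (\<forall>f. \<exists>w \<in> lists S. prod_list w = f)"

text \<open>The set in question is nonempty for every \<open>f\<close> as soon as \<open>S\<close> generates, so
  \<open>LEAST\<close> is then a genuine minimum.\<close>

definition len :: "'a::monoid_mult set \<Rightarrow> 'a \<Rightarrow> nat" where
  "len S f = (LEAST n. \<exists>w \<in> lists S. length w = n \<and> prod_list w = f)"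

definition factorisation_map :: "'a::monoid_mult set \<Rightarrow> ('a \<Rightarrow> 'a \<times> 'a) \<Rightarrow> bool" where
  "factorisation_map S \<eta> \<longleftrightarrow>
     \<eta> 1 = (1, 1) \<and>
     (\<forall>f. f \<noteq> 1 \<longrightarrow>
        fst (\<eta> f) \<in> S - {1} \<and>
        fst (\<eta> f) * snd (\<eta> f) = f \<and>
        len S f = len S (fst (\<eta> f)) + len S (snd (\<eta> f)))"

text \<open>\<open>F\<^sub>1\<close> and \<open>F\<^sub>2\<close> on triples; only triples are needed.\<close>

definition at1 :: "('a \<times> 'a \<Rightarrow> 'a \<times> 'a) \<Rightarrow> 'a \<times> 'a \<times> 'a \<Rightarrow> 'a \<times> 'a \<times> 'a" where
  "at1 F = (\<lambda>(x, y, z). case F (x, y) of (u, v) \<Rightarrow> (u, v, z))"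

definition at2 :: "('a \<times> 'a \<Rightarrow> 'a \<times> 'a) \<Rightarrow> 'a \<times> 'a \<times> 'a \<Rightarrow> 'a \<times> 'a \<times> 'a" where
  "at2 F = (\<lambda>(x, y, z). case F (y, z) of (u, v) \<Rightarrow> (x, u, v))"

definition len3 :: "'a::monoid_mult set \<Rightarrow> 'a \<times> 'a \<times> 'a \<Rightarrow> nat" where
  "len3 S = (\<lambda>(x, y, z). len S x + len S y + len S z)"

definition factorability_structure :: "'a::monoid_mult set \<Rightarrow> ('a \<Rightarrow> 'a \<times> 'a) \<Rightarrow> bool" where
  "factorability_structure S \<eta> \<longleftrightarrow>
     factorisation_map S \<eta> \<and>
     (let F = \<eta> \<circ> mult_map;
          A = at1 F \<circ> at2 F \<circ> at1 F \<circ> at2 F;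
          B = at2 F \<circ> at1 F \<circ> at2 F;
          C = at2 F \<circ> at1 F \<circ> at2 F \<circ> at1 F
      in \<forall>p. (A p = B p \<and> B p = C p) \<or>
             (len3 S (A p) < len3 S p \<and> len3 S (B p) < len3 S p \<and> len3 S (C p) < len3 S p))"

definition factorable_monoid :: "'a::monoid_mult set \<Rightarrow> ('a \<Rightarrow> 'a \<times> 'a) \<Rightarrow> bool" where
  "factorable_monoid S \<eta> \<longleftrightarrow> generates S \<and> 1 \<in> S \<and> factorability_structure S \<eta>"

text \<open>For a factorable monoid, \<open>phi S \<eta>\<close> maps \<open>S \<times> S\<close> into itself, so the value
  \<^const>\<open>undefined\<close> which \<^const>\<open>restrict\<close> takes elsewhere never enters compositions
  evaluated on triples over \<open>S\<close>.\<close>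

definition phi :: "'a::monoid_mult set \<Rightarrow> ('a \<Rightarrow> 'a \<times> 'a) \<Rightarrow> 'a \<times> 'a \<Rightarrow> 'a \<times> 'a" where
  "phi S \<eta> = restrict (\<eta> \<circ> mult_map) (S \<times> S)"

definition contains_one :: "'a::monoid_mult \<times> 'a \<times> 'a \<Rightarrow> bool" where
  "contains_one = (\<lambda>(x, y, z). x = 1 \<or> y = 1 \<or> z = 1)"

end

theory Submission
  imports Defs
begin

text \<open>Write \<open>f'\<close> and \<open>f''\<close> for the two components of \<open>\<eta> f\<close>, and call a pair \<open>(u, g)\<close> stable if
  \<open>\<eta> (u g) = (u, g)\<close>. Evaluating the factorability condition on \<open>(1, 1, f)\<close> shows that the pair of
  \<open>f'\<close> and \<open>b = (f'')'\<close> is stable; evaluating it on \<open>(u, g, 1)\<close> shows that \<open>(u, g)\<close> is stable as soon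
  as \<open>(u, g')\<close> is. Now induct on the length of \<open>f\<close>, with \<open>\<eta> (s f') = (u, v)\<close>. On \<open>(s, f', b)\<close> the
  maps \<open>\<phi>1 \<phi>2 \<phi>1 \<phi>2\<close> and \<open>\<phi>2 \<phi>1 \<phi>2\<close> agree: if the value of the latter contains \<open>1\<close> this is the
  hypothesis, and otherwise no length is lost and factorability applies. So \<open>(u, (v b)')\<close> is
  stable. By induction \<open>(v b)' = (v f'')'\<close>, hence \<open>(u, v f'')\<close> is stable, which is the claim.\<close>

lemma len_le:
  assumes "w \<in> lists S" and "prod_list w = f"
  shows "len S f \<le> length w"
  unfolding len_def by (rule Least_le) (use assms in blast)

lemma len_word:
  assumes "generates S"
  obtains w where "w \<in> lists S" "prod_list w = f" "length w = len S f"
proof -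
  from assms have "\<exists>n. \<exists>w \<in> lists S. length w = n \<and> prod_list w = f"
    unfolding generates_def by blast
  then have "\<exists>w \<in> lists S. length w = len S f \<and> prod_list w = f"
    unfolding len_def by (rule LeastI_ex)
  then show thesis using that by blast
qed

lemma len_one: "len S 1 = 0"
  using len_le[of "[]" S 1] by simp

lemma len_eq_0_iff:
  assumes "generates S"
  shows "len S f = 0 \<longleftrightarrow> f = 1"
proof
  assume "len S f = 0"
  then show "f = 1" using len_word[OF assms, of f] by (metis length_0_conv prod_list.Nil)
qed (simp add: len_one)

lemma len_eq_1:
  assumes "generates S" and "s \<in> S - {1}"
  shows "len S s = 1"
proof -
  have "len S s \<le> 1" using len_le[of "[s]" S s] assms(2) by simp
  moreover have "len S s \<noteq> 0" using len_eq_0_iff[OF assms(1), of s] assms(2) by simp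
  ultimately show ?thesis by simp
qed

lemma in_S_if_len_le_1:
  assumes "generates S" and "1 \<in> S" and "len S f \<le> 1"
  shows "f \<in> S"
proof -
  obtain w where w: "w \<in> lists S" "prod_list w = f" "length w = len S f"
    using len_word[OF assms(1)] .
  from w(3) assms(3) have "length w \<le> 1" by simp
  then have "w = [] \<or> (\<exists>x. w = [x])" by (cases w) auto
  with w(1,2) show ?thesis using assms(2) by auto
qed

context
  fixes S :: "'a::monoid_mult set" and \<eta> :: "'a \<Rightarrow> 'a \<times> 'a"
  assumes fact: "factorable_monoid S \<eta>"
begin

lemma gen: "generates S" and one_S: "1 \<in> S" and fac: "factorisation_map S \<eta>"
  using fact by (simp_all add: factorable_monoid_def factorability_structure_def)

lemma eta_one: "\<eta> 1 = (1, 1)"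
  and head_in: "f \<noteq> 1 \<Longrightarrow> fst (\<eta> f) \<in> S - {1}"
  using fac by (simp_all add: factorisation_map_def)

lemma eta_mult: "fst (\<eta> f) * snd (\<eta> f) = f"
  using fac by (cases "f = 1") (simp_all add: factorisation_map_def)

lemma len_split: "len S f = len S (fst (\<eta> f)) + len S (snd (\<eta> f))"
proof (cases "f = 1")
  case False
  then show ?thesis using fac unfolding factorisation_map_def by blast
qed (simp add: eta_one len_one)

text \<open>The strict alternative makes all three lengths drop at once, so a single length that
  does not drop rules it out.\<close>

lemma factorability:
  fixes p
  defines "F \<equiv> \<eta> \<circ> mult_map"
  defines "A \<equiv> (at1 F \<circ> at2 F \<circ> at1 F \<circ> at2 F) p"
    and "B \<equiv> (at2 F \<circ> at1 F \<circ> at2 F) p"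
    and "C \<equiv> (at2 F \<circ> at1 F \<circ> at2 F \<circ> at1 F) p"
  assumes "len3 S p \<le> len3 S A \<or> len3 S p \<le> len3 S B \<or> len3 S p \<le> len3 S C"
  shows "A = B" and "B = C"
  using fact assms(5) unfolding factorable_monoid_def factorability_structure_def Let_def
    A_def B_def C_def F_def by (meson leD)+

lemma at_eta:
  "at1 (\<eta> \<circ> mult_map) p =
    (fst (\<eta> (fst p * fst (snd p))), snd (\<eta> (fst p * fst (snd p))), snd (snd p))"
  "at2 (\<eta> \<circ> mult_map) p = (fst p, \<eta> (fst (snd p) * snd (snd p)))"
  by (simp_all add: at1_def at2_def mult_map_def split: prod.split)

lemma head_in_S: "fst (\<eta> f) \<in> S"
  using head_in[of f] eta_one one_S by (cases "f = 1") auto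

text \<open>For s \<noteq> 1 the head takes up the whole length 1 of s, which leaves a tail of
  length 0.\<close>

lemma eta_S:
  assumes "s \<in> S"
  shows "\<eta> s = (s, 1)"
proof (cases "s = 1")
  case False
  then have "len S (snd (\<eta> s)) = 0"
    using len_split[of s] len_eq_1[OF gen, of s] len_eq_1[OF gen head_in, of s] assms by simp
  then have "snd (\<eta> s) = 1" by (simp add: len_eq_0_iff[OF gen])
  with eta_mult[of s] show ?thesis by (simp add: prod_eq_iff)
qed (simp add: eta_one)

text \<open>The head uses up one of at most two letters. With \<open>head_in_S\<close> this makes
  \<open>phi\<close> a self-map of \<open>S \<times> S\<close>.\<close>

lemma tail_in_S:
  assumes "s \<in> S" and "t \<in> S"
  shows "snd (\<eta> (s * t)) \<in> S"
proof (cases "s * t = 1")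
  case False
  have "len S (s * t) \<le> 2" using len_le[of "[s, t]" S "s * t"] assms by simp
  then have "len S (snd (\<eta> (s * t))) \<le> 1"
    using len_split[of "s * t"] len_eq_1[OF gen head_in[OF False]] by simp
  then show ?thesis by (rule in_S_if_len_le_1[OF gen one_S])
qed (simp add: eta_one one_S)

lemma head_stable:
  "\<eta> (fst (\<eta> f) * fst (\<eta> (snd (\<eta> f)))) = (fst (\<eta> f), fst (\<eta> (snd (\<eta> f))))"
proof -
  \<comment> \<open>\<open>at2\<close>, \<open>at1\<close>, \<open>at2\<close> lead from (1, 1, f)
    via (1, f', f'') and (f', 1, f'') to (f', \<eta> f''), with no loss of length. Hence one further
    \<open>at1\<close> fixes this triple.\<close>
  have "len3 S (1, 1, f) \<le> len3 S (fst (\<eta> f), \<eta> (snd (\<eta> f)))"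
    using len_split[of f] len_split[of "snd (\<eta> f)"]
    by (simp add: len3_def len_one split_beta)
  then show ?thesis
    using factorability(1)[of "(1, 1, f)"] eta_S[OF head_in_S, of f]
    by (simp add: at_eta eta_mult prod_eq_iff)
qed

lemma stable_if_head_stable:
  assumes "\<eta> (u * fst (\<eta> g)) = (u, fst (\<eta> g))"
  shows "\<eta> (u * g) = (u, g)"
proof -
  define k where "k = u * g"
  have "len3 S (u, g, 1) \<le> len3 S (u, \<eta> g)"
    using len_split[of g] by (simp add: len3_def len_one split_beta)
  \<comment> \<open>On the left, \<open>at1\<close> fixes (u, g', g'') by assumption. On the right,
    \<open>at1\<close> and \<open>at2\<close> produce (k', \<eta> k''), which
    \<open>head_stable\<close> keeps fixed under the other two maps.\<close>
  then have "(u, \<eta> g) = (fst (\<eta> k), \<eta> (snd (\<eta> k)))"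
    using factorability(2)[of "(u, g, 1)"] assms head_stable[of k]
    by (simp add: at_eta eta_mult k_def[symmetric])
  \<comment> \<open>Multiplying the components of \<open>\<eta> g\<close> and of \<eta> k'' turns
    their equality into g = k''.\<close>
  then show ?thesis
    unfolding k_def[symmetric] by (metis eta_mult prod.collapse prod.inject)
qed

lemma phi_eq: "x \<in> S \<Longrightarrow> y \<in> S \<Longrightarrow> phi S \<eta> (x, y) = \<eta> (x * y)"
  by (simp add: phi_def mult_map_def)

lemma at_phi:
  "x \<in> S \<Longrightarrow> y \<in> S \<Longrightarrow>
    at1 (phi S \<eta>) (x, y, z) = (fst (\<eta> (x * y)), snd (\<eta> (x * y)), z)"
  "y \<in> S \<Longrightarrow> z \<in> S \<Longrightarrow> at2 (phi S \<eta>) (x, y, z) = (x, \<eta> (y * z))"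
  by (simp_all add: at1_def at2_def phi_eq split: prod.split)

lemma mult_stable:
  assumes loc: "\<And>r s t. r \<in> S - {1} \<Longrightarrow> s \<in> S - {1} \<Longrightarrow> t \<in> S - {1} \<Longrightarrow>
      contains_one ((at2 (phi S \<eta>) \<circ> at1 (phi S \<eta>) \<circ> at2 (phi S \<eta>)) (r, s, t)) \<Longrightarrow>
      (at1 (phi S \<eta>) \<circ> at2 (phi S \<eta>) \<circ> at1 (phi S \<eta>) \<circ> at2 (phi S \<eta>)) (r, s, t)
        = (at2 (phi S \<eta>) \<circ> at1 (phi S \<eta>) \<circ> at2 (phi S \<eta>)) (r, s, t)"
    and s: "s \<in> S - {1}" and a: "a \<in> S - {1}" and b: "b \<in> S - {1}"
    and ab: "\<eta> (a * b) = (a, b)"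
  defines "u \<equiv> fst (\<eta> (s * a))" and "v \<equiv> snd (\<eta> (s * a))"
  shows "\<eta> (u * fst (\<eta> (v * b))) = (u, fst (\<eta> (v * b)))"
proof -
  define x y where "x = fst (\<eta> (v * b))" and "y = snd (\<eta> (v * b))"
  have xy: "\<eta> (v * b) = (x, y)" by (simp add: x_def y_def)
  have u: "u \<in> S" and v: "v \<in> S" and x: "x \<in> S" and y: "y \<in> S"
    using s a b by (auto simp: u_def v_def x_def y_def intro: head_in_S tail_in_S)
  have B: "(at2 (phi S \<eta>) \<circ> at1 (phi S \<eta>) \<circ> at2 (phi S \<eta>)) (s, a, b) = (u, x, y)"
    using s a b v by (simp add: at_phi ab xy flip: u_def v_def)
  have "\<eta> (u * x) = (u, x)"
  proof (cases "contains_one (u, x, y)")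
    case True
    \<comment> \<open>The two sides of the local condition differ by one last
      \<open>at1\<close>.\<close>
    with loc[OF s a b] B have "at1 (phi S \<eta>) (u, x, y) = (u, x, y)" by (simp add: o_def)
    then show ?thesis using u x by (simp add: at_phi prod_eq_iff)
  next
    case False
    \<comment> \<open>Both triples consist of nontrivial elements of \<open>S\<close>, so both have
      length 3.\<close>
    then have "len3 S (s, a, b) = len3 S (u, x, y)"
      using s a b u x y by (simp add: contains_one_def len3_def len_eq_1[OF gen])
    then show ?thesis
      using factorability(1)[of "(s, a, b)"] by (simp add: at_eta ab xy prod_eq_iff flip: u_def v_def)
  qed
  then show ?thesis by (simp add: x_def)
qed

end

theorem proposition4p2p10:
  fixes S :: "'a::monoid_mult set"
    and \<eta> :: "'a \<Rightarrow> 'a \<times> 'a"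
    and \<phi>1 \<phi>2 :: "'a \<times> 'a \<times> 'a \<Rightarrow> 'a \<times> 'a \<times> 'a"
  defines "\<phi>1 \<equiv> at1 (phi S \<eta>)"
    and "\<phi>2 \<equiv> at2 (phi S \<eta>)"
  assumes "factorable_monoid S \<eta>"
    and "\<And>r s t. r \<in> S - {1} \<Longrightarrow> s \<in> S - {1} \<Longrightarrow> t \<in> S - {1} \<Longrightarrow>
           contains_one ((\<phi>2 \<circ> \<phi>1 \<circ> \<phi>2) (r, s, t)) \<Longrightarrow>
           (\<phi>1 \<circ> \<phi>2 \<circ> \<phi>1 \<circ> \<phi>2) (r, s, t) = (\<phi>2 \<circ> \<phi>1 \<circ> \<phi>2) (r, s, t)"
  shows "\<forall>s \<in> S - {1}. \<forall>f.
           fst (\<eta> (s * f)) = fst (\<eta> (s * fst (\<eta> f))) \<and>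
           snd (\<eta> (s * f)) = snd (\<eta> (s * fst (\<eta> f))) * snd (\<eta> f)"
proof -
  note fact = assms(3)
  note [simp] = eta_S[OF fact]
  have main: "\<eta> (s * f) = (fst (\<eta> (s * fst (\<eta> f))), snd (\<eta> (s * fst (\<eta> f))) * snd (\<eta> f))"
    if "s \<in> S - {1}" for s f
    using that
  \<comment> \<open>\<open>s\<close> is generalised because the induction hypothesis is applied to
    the product of v and h.\<close>
  proof (induction "len S f" arbitrary: s f rule: less_induct)
    case less
    define a h where "a = fst (\<eta> f)" and "h = snd (\<eta> f)"
    define u v b where "u = fst (\<eta> (s * a))" and "v = snd (\<eta> (s * a))" and "b = fst (\<eta> h)"
    have f: "a * h = f" unfolding a_def h_def by (rule eta_mult[OF fact])
    show ?case
    proof (cases "h = 1")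
      case True
      with f have "fst (\<eta> f) = f" "snd (\<eta> f) = 1" by (simp_all add: a_def h_def)
      then show ?thesis by simp
    next
      case False
      then have "f \<noteq> 1" using eta_one[OF fact] by (auto simp: h_def)
      then have a: "a \<in> S - {1}" unfolding a_def by (rule head_in[OF fact])
      have b: "b \<in> S - {1}" using False unfolding b_def by (rule head_in[OF fact])
      have v: "v \<in> S" using less.prems a unfolding v_def by (auto intro: tail_in_S[OF fact])
      have len_h: "len S h < len S f"
        using len_split[OF fact, of f] len_eq_1[OF gen[OF fact] a] by (simp add: a_def h_def)
      have "fst (\<eta> (v * h)) = fst (\<eta> (v * b))"
      proof (cases "v = 1")
        \<comment> \<open>The induction hypothesis does not cover v = 1, but then both heads are b,
          since \<eta> b = (b, 1).\<close>
        case True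
        then show ?thesis using b by (simp add: b_def)
      next
        case False
        with v have "v \<in> S - {1}" by simp
        show ?thesis
          unfolding b_def
          by (subst less.hyps[OF len_h \<open>v \<in> S - {1}\<close>]) simp
      qed
      moreover have "\<eta> (u * fst (\<eta> (v * b))) = (u, fst (\<eta> (v * b)))"
        unfolding u_def v_def
      proof (rule mult_stable[OF fact _ less.prems a b])
        show "\<eta> (a * b) = (a, b)"
          unfolding a_def b_def h_def by (rule head_stable[OF fact])
      qed (rule assms(4)[unfolded \<phi>1_def \<phi>2_def])
      \<comment> \<open>Replacing (v b)' by the equal head (v h)' gives the premise of
        \<open>stable_if_head_stable\<close>.\<close>
      ultimately have "\<eta> (u * (v * h)) = (u, v * h)"
        using stable_if_head_stable[OF fact, of u "v * h"] by simp
      moreover have "u * v = s * a" unfolding u_def v_def by (rule eta_mult[OF fact])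
      then have "u * (v * h) = s * f" by (metis f mult.assoc)
      ultimately show ?thesis by (simp flip: a_def h_def u_def v_def)
    qed
  qed
  show ?thesis
    by (intro ballI allI conjI; subst main) simp_all
qed

end
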